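(* Let $N\ge2$, let $A\subset\mathbb{R}^N$ be open, and let $\kappa\colon[0,\infty)\to\mathbb{R}$ be a $C^1$ function satisfying ($\kappa1$) $\lim_{r\to\infty}\kappa(r)=0$ and $\int_{\mathbb{R}^N}|\kappa(\|x\|^2)|\,dx<\infty$; ($\kappa2$) $\lim_{r\to\infty}r\kappa'(r^2)=0$ and $\int_{\mathbb{R}^N}\sup_{b\in K}\big(\|x+b\|\,|\kappa'(\|x+b\|^2)|\big)\,dx<\infty$ for every compact $K\subset\mathbb{R}^N$. For $t>0$, $x\in\mathbb{R}^N$ put $h(t,x)=\int_{A}t^{-N/2}\kappa(\|x-y\|^2/t)\,dy$. Let $p\in\partial A$. Suppose that there are an open cone $C$ at $p$ and a function $R\colon(0,1)\to(0,\infty)$ such that $$\lim_{t\to0^+}R(t)=\infty,\qquad \lim_{t\to0^+}\sqrt t\,R(t)=0,\qquad \lim_{t\to0^+}t^{-\frac N2}|U_t\,\Delta\,V_t|=0,$$ where $U_t=\{w\in A-p:\|w\|\le\sqrt t\,R(t)\}$ and $V_t=\{w\in C-p:\|w\|\le\sqrt t\,R(t)\}$. Then $$\nabla_xh(t,p)=-\frac{2}{\sqrt t}\left(\int_{C-p}z\,\kappa'(\|z\|^2)\,dz+o(1)\right)\quad\text{as }t\to0^+.$$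
   Context: A subset $C\subset\mathbb{R}^N$ is a cone at $p\in\mathbb{R}^N$ if for every $z\in C-p$ the half-line $\{tz:t>0\}$ is contained in $C-p$ (the empty set is allowed). $|\cdot|$ of a set is Lebesgue measure, $\Delta$ between sets is symmetric difference, $A-p=\{y-p:y\in A\}$. The term $o(1)$ is $\mathbb{R}^N$-valued and tends to $0$. Condition ($\kappa2$) ensures that $h(t,\cdot)$ is differentiable, with gradient obtained by differentiating under the integral. *)

theory Defs
  imports "HOL-Analysis.Analysis"
begin

definition recentre :: "'a::ab_group_add set \<Rightarrow> 'a \<Rightarrow> 'a set"
  where "recentre A p = (\<lambda>y. y - p) ` A"

text \<open>
  Unlike \<open>cone\<close> and \<open>conic\<close> of the library, the half-lines do not contain their origin,
  so a cone at \<open>p\<close> need not contain \<open>p\<close> and can be open without being the whole space.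
\<close>
definition cone_at :: "'a::real_vector \<Rightarrow> 'a set \<Rightarrow> bool"
  where "cone_at p C \<longleftrightarrow> (\<forall>z\<in>recentre C p. \<forall>t>0. t *\<^sub>R z \<in> recentre C p)"

definition truncated :: "'a::real_normed_vector set \<Rightarrow> 'a \<Rightarrow> real \<Rightarrow> 'a set"
  where "truncated A p \<rho> = {w \<in> recentre A p. norm w \<le> \<rho>}"

text \<open>
  Continuous differentiability on the closed half-line (one-sided at \<open>0\<close>). The values of
  \<open>\<kappa>\<close> and \<open>\<kappa>'\<close> at negative arguments are irrelevant.
\<close>
definition C1_halfline :: "(real \<Rightarrow> real) \<Rightarrow> (real \<Rightarrow> real) \<Rightarrow> bool"
  where "C1_halfline \<kappa> \<kappa>' \<longleftrightarrow>
    (\<forall>r\<ge>0. (\<kappa> has_real_derivative \<kappa>' r) (at r within {0..})) \<and> continuous_on {0..} \<kappa>'"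

definition kappa1 :: "'n::finite itself \<Rightarrow> (real \<Rightarrow> real) \<Rightarrow> bool"
  where "kappa1 _ \<kappa> \<longleftrightarrow>
    (\<kappa> \<longlongrightarrow> 0) at_top \<and>
    (\<integral>\<^sup>+ x. ennreal \<bar>\<kappa> ((norm (x :: real ^ 'n))\<^sup>2)\<bar> \<partial>lebesgue) < \<infinity>"

text \<open>
  The supremum is taken in \<^typ>\<open>ennreal\<close>, so that it is \<open>0\<close> for \<open>K = {}\<close>.
\<close>
definition kappa2 :: "'n::finite itself \<Rightarrow> (real \<Rightarrow> real) \<Rightarrow> bool"
  where "kappa2 _ \<kappa>' \<longleftrightarrow>
    ((\<lambda>r. r * \<kappa>' (r\<^sup>2)) \<longlongrightarrow> 0) at_top \<and>
    (\<forall>K :: (real ^ 'n) set. compact K \<longrightarrow>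
      (\<integral>\<^sup>+ x. (SUP b\<in>K. ennreal (norm (x + b) * \<bar>\<kappa>' ((norm (x + b))\<^sup>2)\<bar>)) \<partial>lebesgue) < \<infinity>)"

definition kernel_content ::
    "(real \<Rightarrow> real) \<Rightarrow> (real ^ 'n::finite) set \<Rightarrow> real \<Rightarrow> real ^ 'n \<Rightarrow> real"
  where "kernel_content \<kappa> A t x =
    (LINT y:A|lebesgue. t powr (- real CARD('n) / 2) * \<kappa> ((norm (x - y))\<^sup>2 / t))"

end

theory Submission
  imports Defs
begin

text \<open>
  Put \<open>g z = \<kappa>' (\<parallel>z\<parallel>\<^sup>2) z\<close>. Substituting \<open>y = p + \<surd>t z\<close> turns the gradient at \<open>p\<close> into \<open>- 2 / \<surd>t\<close> times
  the integral of \<open>g\<close> over \<open>(A - p) / \<surd>t\<close>, while \<open>C - p\<close> is invariant under scaling. So the error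
  is the difference of the integrals of \<open>g\<close> over \<open>(A - p) / \<surd>t\<close> and \<open>C - p\<close>. Within radius
  \<open>R t\<close> it is at most \<open>sup \<parallel>g\<parallel>\<close> times the rescaled measure of the symmetric difference, and
  beyond that radius it is at most the tail of the convergent integral of \<open>\<parallel>g\<parallel>\<close>.
\<close>

section \<open>Set integrals, affine substitution and measurability\<close>

lemma set_lebesgue_integral_lborel:
  fixes f :: "'a::euclidean_space \<Rightarrow> 'b::{banach, second_countable_topology}"
  assumes [measurable]: "f \<in> borel_measurable borel" "S \<in> sets borel"
  shows "(LINT y:S|lebesgue. f y) = (LINT y:S|lborel. f y)"
  unfolding set_lebesgue_integral_def by (rule integral_completion) measurable

text \<open>\<open>lborel\<close> is its own image under the affine map, weighted by the constant
  Jacobian. The rules for densities and image measures need only measurability, so no integrability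
  of \<open>f\<close> has to be assumed.\<close>

lemma set_lborel_integral_affine:
  fixes f :: "'a::euclidean_space \<Rightarrow> 'b::{banach, second_countable_topology}"
  assumes [measurable]: "f \<in> borel_measurable borel" "S \<in> sets borel" and "c \<noteq> 0"
  shows "(LINT y:S|lborel. f y) =
    \<bar>c\<bar> ^ DIM('a) *\<^sub>R (LINT z:{z. p + c *\<^sub>R z \<in> S}|lborel. f (p + c *\<^sub>R z))"
proof -
  have "(LINT y:S|lborel. f y) = integral\<^sup>L
      (density (distr lborel borel (\<lambda>x. p + c *\<^sub>R x)) (\<lambda>_. \<bar>c\<bar>^DIM('a))) (\<lambda>x. indicator S x *\<^sub>R f x)"
    unfolding set_lebesgue_integral_def using lborel_affine[OF \<open>c \<noteq> 0\<close>, of p] by simp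
  also have "\<dots> = integral\<^sup>L (distr lborel borel (\<lambda>x. p + c *\<^sub>R x))
      (\<lambda>x. \<bar>c\<bar>^DIM('a) *\<^sub>R (indicator S x *\<^sub>R f x))"
    by (rule integral_density) auto
  also have "\<dots> = integral\<^sup>L lborel
      (\<lambda>z. \<bar>c\<bar>^DIM('a) *\<^sub>R (indicator S (p + c *\<^sub>R z) *\<^sub>R f (p + c *\<^sub>R z)))"
    by (rule integral_distr) auto
  also have "\<dots> = \<bar>c\<bar> ^ DIM('a) *\<^sub>R (LINT z:{z. p + c *\<^sub>R z \<in> S}|lborel. f (p + c *\<^sub>R z))"
    unfolding set_lebesgue_integral_def integral_scaleR_right by (simp add: indicator_def)
  finally show ?thesis .
qed

text \<open>The index set may be uncountable, so countable suprema do not suffice. Instead, every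
  strict superlevel set of the supremum is a union of open sets and hence open.\<close>

lemma borel_measurable_SUP_continuous:
  fixes f :: "'i \<Rightarrow> 'a::topological_space \<Rightarrow> ennreal"
  assumes "\<And>i. i \<in> I \<Longrightarrow> continuous_on UNIV (f i)"
  shows "(\<lambda>x. SUP i\<in>I. f i x) \<in> borel_measurable borel"
proof (rule borel_measurableI_greater)
  fix y
  have "{x \<in> space borel. y < (SUP i\<in>I. f i x)} = (\<Union>i\<in>I. {x. y < f i x})"
    by (auto simp: less_SUP_iff)
  moreover have "open {x. y < f i x}" if "i \<in> I" for i
    using assms[OF that] by (intro open_Collect_less) auto
  ultimately show "{x \<in> space borel. y < (SUP i\<in>I. f i x)} \<in> sets borel"
    by (simp add: open_UN)
qed

section \<open>Differentiation under the integral sign\<close>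

text \<open>Dominated convergence for the difference quotients. A bound on the gradient that is
  uniform over unit translates is needed, since the mean value inequality looks at the gradient
  along the whole segment from \<open>z\<close> to \<open>z + h\<close>.\<close>

lemma differentiable_under_set_integral_translate:
  fixes F :: "'a::euclidean_space \<Rightarrow> real" and g :: "'a \<Rightarrow> 'a"
  assumes F: "\<And>z. (F has_derivative (\<lambda>v. v \<bullet> g z)) (at z)"
    and intF: "integrable lborel F"
    and g: "continuous_on UNIV g"
    and w: "integrable lborel w" "\<And>z b. norm b \<le> 1 \<Longrightarrow> norm (g (z + b)) \<le> w z"
    and S[measurable]: "S \<in> sets borel"
  shows "((\<lambda>u. LINT z:S|lborel. F (z + u)) has_derivative
          (\<lambda>v. v \<bullet> (LINT z:S|lborel. g z))) (at 0)"
proof -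
  have contF: "continuous_on UNIV F"
    using F by (meson continuous_at_imp_continuous_on has_derivative_continuous)
  have [measurable]: "F \<in> borel_measurable borel" "g \<in> borel_measurable borel"
    using contF g by (auto intro: borel_measurable_continuous_onI)
  have w0: "norm (g z) \<le> w z" for z
    using w(2)[of 0 z] by simp
  have intg: "integrable lborel g"
    by (rule Bochner_Integration.integrable_bound[OF w(1)])
       (auto intro!: AE_I2 order_trans[OF w0])
  have intFu: "set_integrable lborel S (\<lambda>z. F (z + u))" for u
  proof -
    have "integrable lborel (\<lambda>z. F (u + z))"
      using intF lborel_distr_plus[of u] integrable_distr_eq[of "(+) u" lborel borel F] by simp
    then show ?thesis
      unfolding set_integrable_def by (intro integrable_mult_indicator) (auto simp: add.commute)
  qed
  have intgS: "set_integrable lborel S g"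
    unfolding set_integrable_def by (intro integrable_mult_indicator intg) auto
  \<comment> \<open>\<open>q h\<close> is the normalised first-order remainder of \<open>F\<close>.
    By linearity its integral over \<open>S\<close> is the remainder of the integrated function
    (\<open>qS\<close>), so the claim is that this integral tends to \<open>0\<close>.\<close>
  define q where "q h z = (F (z + h) - F z - h \<bullet> g z) / norm h" for h z
  have qS: "(LINT z:S|lborel. q h z) = ((LINT z:S|lborel. F (z + h)) - (LINT z:S|lborel. F z)
       - h \<bullet> (LINT z:S|lborel. g z)) / norm h" for h
  proof -
    have 1: "set_integrable lborel S (\<lambda>z. h \<bullet> g z)"
    proof -
      have "integrable lborel (\<lambda>z. h \<bullet> (indicator S z *\<^sub>R g z))"
        using intgS unfolding set_integrable_def by (intro integrable_inner_right)
      then show ?thesis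
        unfolding set_integrable_def by simp
    qed
    have 2: "(LINT z:S|lborel. h \<bullet> g z) = h \<bullet> (LINT z:S|lborel. g z)"
      unfolding set_lebesgue_integral_def
      using intgS[unfolded set_integrable_def]
      by (subst integral_inner_right[symmetric]) auto
    show ?thesis
      unfolding q_def 2[symmetric]
      using intFu[of h] intFu[of 0] 1
      by (simp add: set_integral_diff set_integral_divide_zero)
  qed
  have q_bound: "\<bar>q h z\<bar> \<le> 2 * w z" if "norm h \<le> 1" "h \<noteq> 0" for h z
  proof -
    \<comment> \<open>Mean value inequality on the unit ball around \<open>z\<close>, which contains
      \<open>z + h\<close>; there the derivative has operator norm at most \<open>w z\<close>. The
      linear term contributes the second \<open>w z\<close> in the bound.\<close>
    have "norm (F (z + h) - F z) \<le> w z * norm (z + h - z)"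
    proof (rule differentiable_bound[of "cball z 1" F "\<lambda>x v. v \<bullet> g x"])
      show "onorm (\<lambda>v. v \<bullet> g x) \<le> w z" if "x \<in> cball z 1" for x
      proof (rule onorm_bound)
        show "norm (v \<bullet> g x) \<le> w z * norm v" for v
        proof -
          have "norm (v \<bullet> g x) \<le> norm v * norm (g x)"
            using Cauchy_Schwarz_ineq2[of v "g x"] by simp
          also have "\<dots> \<le> norm v * w z"
            using w(2)[of "x - z" z] that
            by (intro mult_left_mono) (auto simp: dist_norm norm_minus_commute)
          finally show ?thesis by (simp add: mult.commute)
        qed
      qed (use order_trans[OF norm_ge_zero w0] in auto)
    qed (use that F in \<open>auto intro: has_derivative_at_withinI simp: dist_norm\<close>)
    moreover have "\<bar>h \<bullet> g z\<bar> \<le> w z * norm h"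
      using Cauchy_Schwarz_ineq2[of h "g z"] mult_right_mono[OF w0[of z], of "norm h"]
      by (simp add: mult.commute)
    ultimately have "\<bar>F (z + h) - F z - h \<bullet> g z\<bar> \<le> 2 * w z * norm h"
      by (simp add: algebra_simps)
    then show ?thesis
      using that by (simp add: q_def abs_divide divide_le_eq)
  qed
  have q_lim: "((\<lambda>h. q h z) \<longlongrightarrow> 0) (at 0)" for z
  proof -
    have "((\<lambda>h. norm (F (z + h) - F z - h \<bullet> g z) / norm h) \<longlongrightarrow> 0) (at 0)"
      using F[of z] unfolding has_derivative_at by blast
    then show ?thesis
      by (subst tendsto_rabs_zero_iff[symmetric]) (simp add: q_def abs_divide)
  qed
  have lim: "((\<lambda>h. LINT z:S|lborel. q h z) \<longlongrightarrow> 0) (at 0)"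
    unfolding tendsto_at_iff_sequentially
  proof (intro allI impI)
    fix X :: "nat \<Rightarrow> 'a"
    assume nz: "\<forall>i. X i \<in> UNIV - {0}" and X: "X \<longlonglongrightarrow> 0"
    have "\<forall>\<^sub>F i in sequentially. norm (X i) < 1"
      using tendsto_norm[OF X] by (intro order_tendstoD(2)[of _ 0]) auto
    then obtain N where N: "\<And>i. i \<ge> N \<Longrightarrow> norm (X i) < 1"
      by (auto simp: eventually_sequentially)
    \<comment> \<open>Dropping the first \<open>N\<close> terms makes every increment shorter than
      \<open>1\<close>, so that \<open>q_bound\<close> holds for all indices.\<close>
    have "(\<lambda>i. LINT z|lborel. indicator S z *\<^sub>R q (X (i + N)) z) \<longlonglongrightarrow> (LINT z::'a|lborel. (0::real))"
    proof (rule integral_dominated_convergence[where w="\<lambda>z. 2 * w z"])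
      have "(\<lambda>i. q (X (i + N)) z) \<longlonglongrightarrow> 0" for z
      proof -
        have "((\<lambda>h. q h z) \<circ> X) \<longlonglongrightarrow> 0"
          using q_lim[of z, unfolded tendsto_at_iff_sequentially] nz X by blast
        from LIMSEQ_ignore_initial_segment[OF this, of N] show ?thesis
          by (simp add: o_def)
      qed
      then show "AE z in lborel. (\<lambda>i. indicator S z *\<^sub>R q (X (i + N)) z) \<longlonglongrightarrow> 0"
        by (auto intro!: AE_I2 simp: indicator_def)
      have "\<bar>q (X (i + N)) z\<bar> \<le> 2 * w z" for i z
        using N[of "i + N"] nz by (intro q_bound) auto
      moreover have "0 \<le> w z" for z
        using order_trans[OF norm_ge_zero w0] .
      ultimately show "AE z in lborel. norm (indicator S z *\<^sub>R q (X (i + N)) z) \<le> 2 * w z" for i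
        by (auto intro!: AE_I2 simp: indicator_def)
    qed (use w(1) in \<open>auto simp: q_def\<close>)
    then have "(\<lambda>i. ((\<lambda>h. LINT z:S|lborel. q h z) \<circ> X) (i + N)) \<longlonglongrightarrow> 0"
      unfolding o_def set_lebesgue_integral_def integral_zero .
    then show "((\<lambda>h. LINT z:S|lborel. q h z) \<circ> X) \<longlonglongrightarrow> 0"
      by (rule LIMSEQ_offset)
  qed
  show ?thesis
    unfolding has_derivative_at
  proof
    show "bounded_linear (\<lambda>v. v \<bullet> (LINT z:S|lborel. g z))"
      by (rule bounded_linear_inner_left)
    show "(\<lambda>h. norm ((LINT z:S|lborel. F (z + (0 + h))) - (LINT z:S|lborel. F (z + 0)) -
         h \<bullet> (LINT z:S|lborel. g z)) / norm h) \<midarrow>0\<rightarrow> 0"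
      using tendsto_rabs_zero[OF lim] unfolding qS by (simp add: abs_divide)
  qed
qed

section \<open>The radial profile and its gradient field\<close>

text \<open>The squared norm is smooth also at the origin and takes values in \<open>{0..}\<close>.
  Hence the chain rule needs the derivative of \<kappa> only within the half-line, and the one-sided
  derivative at \<open>0\<close> is enough.\<close>

lemma has_derivative_radial:
  fixes z :: "'a::real_inner"
  assumes "C1_halfline \<kappa> \<kappa>'"
  shows "((\<lambda>z. \<kappa> ((norm z)\<^sup>2)) has_derivative
          (\<lambda>v. v \<bullet> (2 *\<^sub>R (\<kappa>' ((norm z)\<^sup>2) *\<^sub>R z)))) (at z)"
proof -
  have n: "((\<lambda>z::'a. z \<bullet> z) has_derivative (\<lambda>v. z \<bullet> v + v \<bullet> z)) (at z)"
    by (auto intro!: derivative_eq_intros)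
  have "(\<kappa> has_derivative (\<lambda>x. \<kappa>' (z \<bullet> z) * x)) (at (z \<bullet> z) within {0..})"
    using assms unfolding C1_halfline_def has_field_derivative_def by auto
  then have "(\<kappa> has_derivative (\<lambda>x. \<kappa>' (z \<bullet> z) * x)) (at (z \<bullet> z) within range (\<lambda>z::'a. z \<bullet> z))"
    by (rule has_derivative_subset) auto
  from has_derivative_in_compose[OF n this] show ?thesis
    unfolding power2_norm_eq_inner
    by (rule has_derivative_eq_rhs) (auto simp: inner_commute algebra_simps fun_eq_iff)
qed

lemma continuous_radial_field:
  fixes \<kappa>' :: "real \<Rightarrow> real"
  assumes "C1_halfline \<kappa> \<kappa>'"
  shows "continuous_on UNIV (\<lambda>z::'a::real_normed_vector. \<kappa>' ((norm z)\<^sup>2) *\<^sub>R z)"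
proof -
  have "continuous_on UNIV (\<lambda>z::'a. \<kappa>' ((norm z)\<^sup>2))"
    by (rule continuous_on_compose2[of "{0..}" \<kappa>'])
       (use assms in \<open>auto simp: C1_halfline_def intro!: continuous_intros\<close>)
  then show ?thesis
    by (intro continuous_intros)
qed

text \<open>Beyond some radius the decay of \<open>r * \<kappa>' (r\<^sup>2)\<close> gives the bound
  \<open>1\<close>; the remaining closed ball is compact and the field is continuous.\<close>

lemma bounded_radial_field:
  fixes \<kappa>' :: "real \<Rightarrow> real"
  assumes "C1_halfline \<kappa> \<kappa>'" "((\<lambda>r. r * \<kappa>' (r\<^sup>2)) \<longlongrightarrow> 0) at_top"
  obtains M where "\<And>z::'a::euclidean_space. norm (\<kappa>' ((norm z)\<^sup>2) *\<^sub>R z) \<le> M"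
proof -
  let ?g = "\<lambda>z::'a. \<kappa>' ((norm z)\<^sup>2) *\<^sub>R z"
  have "\<forall>\<^sub>F r in at_top. norm (r * \<kappa>' (r\<^sup>2)) < 1"
    using tendsto_norm[OF assms(2)] by (intro order_tendstoD(2)[of _ 0]) auto
  then obtain \<rho> where \<rho>: "\<And>r. r \<ge> \<rho> \<Longrightarrow> \<bar>r * \<kappa>' (r\<^sup>2)\<bar> < 1"
    by (auto simp: eventually_at_top_linorder)
  have "compact (?g ` cball 0 \<rho>)"
    by (intro compact_continuous_image continuous_on_subset[OF continuous_radial_field[OF assms(1)]])
       auto
  then obtain B where B: "\<And>z. z \<in> cball 0 \<rho> \<Longrightarrow> norm (?g z) \<le> B"
    by (meson bounded_iff compact_imp_bounded imageI)
  have "norm (?g z) \<le> max B 1" for z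
    using B[of z] \<rho>[of "norm z"]
    by (cases "norm z \<le> \<rho>") (auto simp: abs_mult mult.commute max.coboundedI1 max.coboundedI2)
  then show ?thesis
    by (rule that)
qed

text \<open>Supplies the dominating function for differentiation under the integral: the supremum of
  the field over translates by the closed unit ball, whose integral \<open>kappa2\<close> makes
  finite.\<close>

lemma radial_field_dominated:
  assumes "C1_halfline \<kappa> \<kappa>'" "kappa2 TYPE('n::finite) \<kappa>'"
  obtains w :: "real^'n \<Rightarrow> real" where "integrable lborel w"
    "\<And>z b. norm b \<le> 1 \<Longrightarrow> norm (\<kappa>' ((norm (z + b))\<^sup>2) *\<^sub>R (z + b)) \<le> w z"
proof -
  define g :: "real^'n \<Rightarrow> real^'n" where "g z = \<kappa>' ((norm z)\<^sup>2) *\<^sub>R z" for z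
  obtain M where M: "\<And>z::real^'n. norm (g z) \<le> M"
    using bounded_radial_field[OF assms(1)] assms(2) unfolding kappa2_def g_def by blast
  have contg: "continuous_on UNIV g"
    unfolding g_def by (rule continuous_radial_field[OF assms(1)])
  \<comment> \<open>\<open>W\<close> is finite everywhere because \<open>g\<close> is bounded, so \<^const>\<open>enn2real\<close> loses nothing.\<close>
  define W where "W z = (SUP b\<in>cball 0 1. ennreal (norm (g (z + b))))" for z
  have [measurable]: "W \<in> borel_measurable borel"
    unfolding W_def
    by (intro borel_measurable_SUP_continuous continuous_on_ennreal continuous_intros
        continuous_on_compose2[OF contg]) auto
  have "W z \<le> ennreal M" for z
    unfolding W_def by (intro SUP_least ennreal_leI M)
  then have W_fin: "W z < \<infinity>" for z
    by (metis ennreal_less_top infinity_ennreal_def le_less_trans)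
  have "(\<integral>\<^sup>+ z. W z \<partial>lebesgue) < \<infinity>"
    using assms(2) compact_cball[of "0::real^'n" 1] unfolding kappa2_def W_def g_def
    by (auto simp: mult.commute)
  then have W_int: "(\<integral>\<^sup>+ z. W z \<partial>lborel) < \<infinity>"
    by (simp add: nn_integral_completion)
  show ?thesis
  proof (rule that[of "\<lambda>z. enn2real (W z)"])
    show "integrable lborel (\<lambda>z. enn2real (W z))"
      using W_int W_fin by (intro integrableI_bounded) (auto simp: less_top[symmetric])
    show "norm (\<kappa>' ((norm (z + b))\<^sup>2) *\<^sub>R (z + b)) \<le> enn2real (W z)" if "norm b \<le> 1" for z b
    proof -
      have "ennreal (norm (g (z + b))) \<le> W z"
        unfolding W_def using that by (intro SUP_upper) auto
      from enn2real_mono[OF this] W_fin show ?thesis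
        by (simp add: g_def)
    qed
  qed
qed

lemma integrable_radial:
  assumes "C1_halfline \<kappa> \<kappa>'" "kappa1 TYPE('n::finite) \<kappa>"
  shows "integrable lborel (\<lambda>z::real^'n. \<kappa> ((norm z)\<^sup>2))"
proof -
  have "continuous_on UNIV (\<lambda>z::real^'n. \<kappa> ((norm z)\<^sup>2))"
    by (intro continuous_at_imp_continuous_on ballI
        has_derivative_continuous[OF has_derivative_radial[OF assms(1)]])
  then have [measurable]: "(\<lambda>z::real^'n. \<kappa> ((norm z)\<^sup>2)) \<in> borel_measurable borel"
    by (rule borel_measurable_continuous_onI)
  show ?thesis
    using assms(2) unfolding kappa1_def
    by (intro integrableI_bounded) (auto simp: nn_integral_completion)
qed

section \<open>The gradient of the kernel content\<close>

lemma powr_half_dim_cancel: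
  fixes t :: real
  assumes "t > 0"
  shows "t powr (- real n / 2) * sqrt t ^ n = 1"
  using assms
  by (simp add: powr_half_sqrt[symmetric] powr_realpow[symmetric] powr_powr powr_add[symmetric])

text \<open>The substitution is centred at \<open>p\<close> and not at \<open>x\<close>: the domain
  is then independent of \<open>x\<close>, which enters only through a translation of the argument.
  The Jacobian cancels the factor in front of the kernel.\<close>

lemma kernel_content_rescaled:
  fixes A :: "(real ^ 'n::finite) set"
  assumes "C1_halfline \<kappa> \<kappa>'" "A \<in> sets borel" "t > 0"
  shows "kernel_content \<kappa> A t x =
    (LINT z:{z. p + sqrt t *\<^sub>R z \<in> A}|lborel. \<kappa> ((norm (z + (p - x) /\<^sub>R sqrt t))\<^sup>2))"
proof -
  have cont: "continuous_on UNIV (\<lambda>z::real^'n. \<kappa> ((norm z)\<^sup>2))"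
    by (intro continuous_at_imp_continuous_on ballI
        has_derivative_continuous[OF has_derivative_radial[OF assms(1)]])
  have eq: "(norm v)\<^sup>2 / t = (norm (v /\<^sub>R sqrt t))\<^sup>2" for v :: "real^'n"
    using \<open>t > 0\<close> by (simp add: power_mult_distrib power_inverse divide_simps)
  have m: "(\<lambda>y. \<kappa> ((norm (x - y))\<^sup>2 / t)) \<in> borel_measurable borel"
    unfolding eq
    by (intro borel_measurable_continuous_onI continuous_on_compose2[OF cont] continuous_intros) auto
  have arg: "(norm (x - (p + sqrt t *\<^sub>R z)))\<^sup>2 / t = (norm (z + (p - x) /\<^sub>R sqrt t))\<^sup>2" for z
  proof -
    have "(x - (p + sqrt t *\<^sub>R z)) /\<^sub>R sqrt t = - (z + (p - x) /\<^sub>R sqrt t)"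
      using \<open>t > 0\<close> by (simp add: algebra_simps)
    then show ?thesis
      unfolding eq by (metis norm_minus_cancel)
  qed
  have "kernel_content \<kappa> A t x =
      t powr (- real CARD('n) / 2) * (LINT y:A|lborel. \<kappa> ((norm (x - y))\<^sup>2 / t))"
    unfolding kernel_content_def using set_lebesgue_integral_lborel[OF m assms(2)] by simp
  also have "(LINT y:A|lborel. \<kappa> ((norm (x - y))\<^sup>2 / t)) = sqrt t ^ CARD('n) *
      (LINT z:{z. p + sqrt t *\<^sub>R z \<in> A}|lborel. \<kappa> ((norm (x - (p + sqrt t *\<^sub>R z)))\<^sup>2 / t))"
    using \<open>t > 0\<close> by (subst set_lborel_integral_affine[OF m assms(2), of "sqrt t" p]) auto
  finally show ?thesis
    unfolding arg using powr_half_dim_cancel[OF \<open>t > 0\<close>, of "CARD('n)"] by (simp flip: mult.assoc)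
qed

text \<open>Chain rule through the translation \<open>(p - x) /\<^sub>R sqrt t\<close>, which
  vanishes at \<open>x = p\<close>. It contributes the factor \<open>- 1 / sqrt t\<close>, and the
  squared norm contributes the \<open>2\<close>.\<close>

lemma GDERIV_kernel_content:
  fixes A :: "(real ^ 'n::finite) set"
  assumes "C1_halfline \<kappa> \<kappa>'" "kappa1 TYPE('n) \<kappa>" "kappa2 TYPE('n) \<kappa>'"
    and A: "A \<in> sets borel" and t: "t > 0"
  shows "GDERIV (kernel_content \<kappa> A t) p :> (- (2 / sqrt t)) *\<^sub>R
    (LINT z:{z. p + sqrt t *\<^sub>R z \<in> A}|lborel. \<kappa>' ((norm z)\<^sup>2) *\<^sub>R z)"
proof -
  let ?F = "\<lambda>z::real^'n. \<kappa> ((norm z)\<^sup>2)" and ?g = "\<lambda>z::real^'n. \<kappa>' ((norm z)\<^sup>2) *\<^sub>R z"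
  let ?S = "{z. p + sqrt t *\<^sub>R z \<in> A}"
  have S: "?S \<in> sets borel"
    using A by measurable
  obtain w where w: "integrable lborel w" "\<And>z b::real^'n. norm b \<le> 1 \<Longrightarrow> norm (?g (z + b)) \<le> w z"
    using radial_field_dominated[OF assms(1,3)] by blast
  have "((\<lambda>u. LINT z:?S|lborel. ?F (z + u)) has_derivative
        (\<lambda>v. v \<bullet> (LINT z:?S|lborel. 2 *\<^sub>R ?g z))) (at 0)"
  proof (rule differentiable_under_set_integral_translate[where w="\<lambda>z. 2 * w z"])
    show "continuous_on UNIV (\<lambda>z. 2 *\<^sub>R ?g z)"
      by (intro continuous_on_scaleR continuous_on_const continuous_radial_field[OF assms(1)])
    show "norm (2 *\<^sub>R ?g (z + b)) \<le> 2 * w z" if "norm b \<le> 1" for z b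
      using w(2)[OF that, of z] unfolding norm_scaleR[of 2] by simp
  qed (use has_derivative_radial[OF assms(1)] integrable_radial[OF assms(1,2)] w S in auto)
  \<comment> \<open>The base point \<open>0\<close> is written as the image of \<open>p\<close>
    under the translation, the form in which the chain rule below expects it.\<close>
  then have *: "((\<lambda>u. LINT z:?S|lborel. ?F (z + u)) has_derivative
        (\<lambda>v. v \<bullet> (2 *\<^sub>R (LINT z:?S|lborel. ?g z)))) (at ((p - p) /\<^sub>R sqrt t))"
    unfolding set_integral_scaleR_right by simp
  have "((\<lambda>x. (p - x) /\<^sub>R sqrt t) has_derivative (\<lambda>v. - v /\<^sub>R sqrt t)) (at p)"
    by (auto intro!: derivative_eq_intros)
  from has_derivative_compose[OF this *] show ?thesis
    unfolding gderiv_def kernel_content_rescaled[OF assms(1) A t, of _ p, abs_def]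
    by (rule has_derivative_eq_rhs) (simp add: fun_eq_iff divide_inverse)
qed

section \<open>The asymptotics of the gradient at \<open>p\<close>\<close>

theorem theorem4:
  fixes A C :: "(real ^ 'n::finite) set"
    and p :: "real ^ 'n"
    and \<kappa> \<kappa>' :: "real \<Rightarrow> real"
    and R :: "real \<Rightarrow> real"
  assumes "CARD('n) \<ge> 2"
    and "open A"
    and "C1_halfline \<kappa> \<kappa>'"
    and "kappa1 TYPE('n) \<kappa>"
    and "kappa2 TYPE('n) \<kappa>'"
    and "p \<in> frontier A"
    and "open C" and "cone_at p C"
    and "\<And>t. t \<in> {0<..<1} \<Longrightarrow> R t > 0"
    and "filterlim R at_top (at_right 0)"
    and "((\<lambda>t. sqrt t * R t) \<longlongrightarrow> 0) (at_right 0)"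
    and "((\<lambda>t. t powr (- real CARD('n) / 2) *
            measure lebesgue (sym_diff (truncated A p (sqrt t * R t))
                                       (truncated C p (sqrt t * R t)))) \<longlongrightarrow> 0) (at_right 0)"
  shows "\<exists>\<omega> :: real \<Rightarrow> real ^ 'n.
           (\<omega> \<longlongrightarrow> 0) (at_right 0) \<and>
           (\<forall>t>0. GDERIV (kernel_content \<kappa> A t) p :>
              (- (2 / sqrt t)) *\<^sub>R
                ((LINT z:recentre C p|lebesgue. \<kappa>' ((norm z)\<^sup>2) *\<^sub>R z) + \<omega> t))"
proof -
  define g :: "real^'n \<Rightarrow> real^'n" where "g z = \<kappa>' ((norm z)\<^sup>2) *\<^sub>R z" for z
  obtain M where M: "\<And>z. norm (g z) \<le> M"
    using bounded_radial_field[OF assms(3)] assms(5) unfolding kappa2_def g_def by blast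
  have [measurable]: "g \<in> borel_measurable borel"
    unfolding g_def by (intro borel_measurable_continuous_onI continuous_radial_field[OF assms(3)])
  obtain w where w: "integrable lborel w" "\<And>z b. norm b \<le> 1 \<Longrightarrow> norm (g (z + b)) \<le> w z"
    using radial_field_dominated[OF assms(3,5)] unfolding g_def by blast
  have intg: "integrable lborel g"
    using w(2)[of 0]
    by (intro Bochner_Integration.integrable_bound[OF w(1)])
       (auto intro!: AE_I2 intro: order_trans[OF _ abs_ge_self])
  define T where "T t = {z. p + sqrt t *\<^sub>R z \<in> A}" for t
  define D where "D = recentre C p"
  have D_eq: "D = {z. p + z \<in> C}" and recentre_A: "recentre A p = {z. p + z \<in> A}"
    unfolding D_def recentre_def by force+
  have [measurable]: "A \<in> sets borel" "C \<in> sets borel"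
    using assms by auto
  have [measurable]: "T t \<in> sets borel" for t
    unfolding T_def by measurable
  have [measurable]: "D \<in> sets borel"
    unfolding D_eq by measurable
  \<comment> \<open>The cone condition gives one direction; scaling by \<open>inverse s\<close>
    gives the other.\<close>
  have D_scale: "s *\<^sub>R z \<in> D \<longleftrightarrow> z \<in> D" if "s > 0" for s z
  proof
    have D: "r *\<^sub>R y \<in> D" if "y \<in> D" "r > 0" for r y
      using assms(8) that unfolding cone_at_def D_def by blast
    show "s *\<^sub>R z \<in> D \<Longrightarrow> z \<in> D"
      using D[of "s *\<^sub>R z" "inverse s"] that by simp
    show "z \<in> D \<Longrightarrow> s *\<^sub>R z \<in> D"
      using D that by blast
  qed
  \<comment> \<open>The exact error, defined by subtraction: the gradient identity then holds for
    every \<open>t > 0\<close>, and only its limit remains to be shown.\<close>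
  define \<omega> where "\<omega> t = (LINT z:T t|lborel. g z) - (LINT z:D|lborel. g z)" for t
  \<comment> \<open>The truncated symmetric difference divided by \<open>sqrt t\<close>, which turns
    the radius \<open>sqrt t * R t\<close> into \<open>R t\<close>.\<close>
  define E where "E t = sym_diff (T t) D \<inter> cball 0 (R t)" for t
  define \<phi> where "\<phi> \<rho> = (LINT z|lborel. indicator {z. norm z > \<rho>} z * norm (g z))" for \<rho>
  have [measurable]: "E t \<in> sets borel" for t
    unfolding E_def by measurable
  have E_fin: "emeasure lborel (E t) < \<infinity>" for t
    by (rule le_less_trans[OF emeasure_mono emeasure_lborel_cball_finite[of "0::real^'n" "R t"]])
       (auto simp: E_def)
  have \<phi>_lim: "(\<phi> \<longlongrightarrow> 0) at_top"
  proof -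
    have "((\<lambda>\<rho>. LINT z|lborel. indicator {z. norm z > \<rho>} z * norm (g z))
        \<longlongrightarrow> (LINT z::real^'n|lborel. (0::real))) at_top"
    proof (rule integral_dominated_convergence_at_top[where w="\<lambda>z. norm (g z)"])
      have "\<forall>\<^sub>F \<rho> in at_top. indicator {z. norm z > \<rho>} z * norm (g z) = 0" for z
        using eventually_ge_at_top[of "norm z"] by eventually_elim auto
      then show "AE z in lborel. ((\<lambda>\<rho>. indicator {z. norm z > \<rho>} z * norm (g z)) \<longlongrightarrow> 0) at_top"
        by (auto intro!: AE_I2 tendsto_eventually)
    qed (use intg in \<open>auto intro!: always_eventually AE_I2 simp: indicator_def\<close>)
    then show ?thesis
      unfolding \<phi>_def by simp
  qed
  \<comment> \<open>This covers also \<open>t\<close> with \<open>R t < 0\<close>: the ball is then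
    empty and the tail is the whole integral of \<open>norm (g z)\<close>.\<close>
  have \<omega>_bound: "norm (\<omega> t) \<le> M * measure lborel (E t) + \<phi> (R t)" for t
  proof -
    have i: "integrable lborel (\<lambda>z. indicator S z *\<^sub>R g z)" if "S \<in> sets borel" for S
      using that by (intro integrable_mult_indicator intg) auto
    have iE: "integrable lborel (\<lambda>z. M * indicator (E t) z)"
      using E_fin by (intro integrable_mult_right integrable_real_indicator) auto
    have "integrable lborel (\<lambda>z. indicator {z. norm z > R t} z *\<^sub>R norm (g z))"
      using intg by (intro integrable_mult_indicator integrable_norm) auto
    then have i\<phi>: "integrable lborel (\<lambda>z. indicator {z. norm z > R t} z * norm (g z))"
      by simp
    have "\<omega> t = (LINT z|lborel. indicator (T t) z *\<^sub>R g z - indicator D z *\<^sub>R g z)"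
      unfolding \<omega>_def set_lebesgue_integral_def by (simp add: i)
    also have "norm \<dots> \<le> (LINT z|lborel. norm (indicator (T t) z *\<^sub>R g z - indicator D z *\<^sub>R g z))"
      by (rule integral_norm_bound)
    also have "\<dots> \<le> (LINT z|lborel. M * indicator (E t) z + indicator {z. norm z > R t} z * norm (g z))"
    proof (intro integral_mono Bochner_Integration.integrable_add iE i\<phi> integrable_norm
        Bochner_Integration.integrable_diff i)
      fix z
      \<comment> \<open>The two terms on the left differ only where exactly one of
        \<open>T t\<close> and \<open>D\<close> contains \<open>z\<close>. Such a \<open>z\<close>
        lies in \<open>E t\<close>, or else its norm exceeds \<open>R t\<close>.\<close>
      show "norm (indicator (T t) z *\<^sub>R g z - indicator D z *\<^sub>R g z)
          \<le> M * indicator (E t) z + indicator {z. norm z > R t} z * norm (g z)"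
      proof (cases "z \<in> E t")
        case True
        then show ?thesis
          using M[of z] by (auto simp: E_def)
      next
        case False
        then show ?thesis
          by (cases "z \<in> T t"; cases "z \<in> D") (auto simp: E_def)
      qed
    qed auto
    also have "\<dots> = M * measure lborel (E t) + \<phi> (R t)"
      unfolding \<phi>_def using E_fin by (subst Bochner_Integration.integral_add[OF iE i\<phi>]) auto
    finally show ?thesis .
  qed
  \<comment> \<open>Scaling back by \<open>sqrt t\<close> leaves \<open>D\<close> invariant and
    multiplies volume by \<open>sqrt t ^ CARD('n)\<close>, which the prefactor cancels. This
    identifies the quantity in the hypothesis with the measure of \<open>E t\<close>.\<close>
  have E_scale: "t powr (- real CARD('n) / 2) *
      measure lebesgue (sym_diff (truncated A p (sqrt t * R t)) (truncated C p (sqrt t * R t)))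
      = measure lborel (E t)" if "t > 0" for t
  proof -
    have "z \<in> (*\<^sub>R) (sqrt t) ` E t \<longleftrightarrow>
        z \<in> sym_diff (truncated A p (sqrt t * R t)) (truncated C p (sqrt t * R t))" for z
    proof -
      have "z \<in> (*\<^sub>R) (sqrt t) ` E t \<longleftrightarrow> inverse (sqrt t) *\<^sub>R z \<in> E t"
        using that by (auto intro!: image_eqI[of _ _ "inverse (sqrt t) *\<^sub>R z"])
      also have "\<dots> \<longleftrightarrow> z \<in> sym_diff (truncated A p (sqrt t * R t)) (truncated C p (sqrt t * R t))"
      proof -
        have 1: "inverse (sqrt t) *\<^sub>R z \<in> T t \<longleftrightarrow> z \<in> recentre A p"
          using that by (simp add: T_def recentre_A)
        have 2: "inverse (sqrt t) *\<^sub>R z \<in> D \<longleftrightarrow> z \<in> recentre C p"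
          using that D_scale[of "inverse (sqrt t)" z] by (simp add: D_def)
        have 3: "inverse (sqrt t) *\<^sub>R z \<in> cball 0 (R t) \<longleftrightarrow> norm z \<le> sqrt t * R t"
          using that by (simp add: divide_simps mult.commute)
        show ?thesis
          unfolding E_def truncated_def using 1 2 3 by blast
      qed
      finally show ?thesis by simp
    qed
    \<comment> \<open>The summand \<open>0\<close> makes the dilation an affine map of the shape in
      \<open>measure_lebesgue_affine\<close>.\<close>
    then have "sym_diff (truncated A p (sqrt t * R t)) (truncated C p (sqrt t * R t))
        = (\<lambda>z. sqrt t *\<^sub>R z + 0) ` E t"
      unfolding add_0_right by (intro set_eqI) (rule sym)
    then have "measure lebesgue (sym_diff (truncated A p (sqrt t * R t)) (truncated C p (sqrt t * R t)))
        = sqrt t ^ CARD('n) * measure lborel (E t)"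
      using that measure_lebesgue_affine[of "sqrt t" 0 "E t"] by simp
    then show ?thesis
      using powr_half_dim_cancel[OF that, of "CARD('n)"] by (simp flip: mult.assoc)
  qed
  have E_lim: "((\<lambda>t. measure lborel (E t)) \<longlongrightarrow> 0) (at_right 0)"
    using assms(12)
    by (rule Lim_transform_eventually)
       (rule eventually_mono[OF eventually_at_right_less], rule E_scale)
  \<comment> \<open>Both conditions on \<open>R\<close> meet here: the measure of \<open>E t\<close>
    vanishes by the hypothesis on the symmetric difference, and the tail vanishes because
    \<open>R t\<close> tends to infinity.\<close>
  have bound_lim: "((\<lambda>t. M * measure lborel (E t) + \<phi> (R t)) \<longlongrightarrow> M * 0 + 0) (at_right 0)"
    by (intro tendsto_intros E_lim filterlim_compose[OF \<phi>_lim assms(10)])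
  have "(\<omega> \<longlongrightarrow> 0) (at_right 0)"
  proof (rule Lim_null_comparison)
    show "\<forall>\<^sub>F t in at_right 0. norm (\<omega> t) \<le> M * measure lborel (E t) + \<phi> (R t)"
      using \<omega>_bound by (simp add: always_eventually)
  qed (use bound_lim in simp)
  moreover have "GDERIV (kernel_content \<kappa> A t) p :> (- (2 / sqrt t)) *\<^sub>R
      ((LINT z:recentre C p|lebesgue. \<kappa>' ((norm z)\<^sup>2) *\<^sub>R z) + \<omega> t)" if "t > 0" for t
  proof -
    have "(LINT z:recentre C p|lebesgue. g z) + \<omega> t = (LINT z:T t|lborel. g z)"
      unfolding \<omega>_def D_def[symmetric] by (subst set_lebesgue_integral_lborel) auto
    then show ?thesis
      using GDERIV_kernel_content[OF assms(3,4,5) _ that, of A p] unfolding g_def T_def by simp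
  qed
  ultimately show ?thesis
    by blast
qed

end
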